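(* Let $\Omega\subset\mathbb H^*$ be an open domain. For every $\alpha\in\mathbb N_0^3$ the function $\mu^\alpha$ is in the kernel of the operator $V_q$ on $\Omega$, i.e. $V_q\mu^\alpha(x)=0$ for every $x\in\Omega$.
   Context: $\mathbb H$ denotes the quaternions with units $\mathbf e_1,\mathbf e_2,\mathbf e_3$. A point $x=(x_0,x_1,x_2,x_3)\in\mathbb R^4$ is identified with $q=x_0+\vec q$, where $\vec q=x_1\mathbf e_1+x_2\mathbf e_2+x_3\mathbf e_3$, and $\mathbb H^*=\{q\in\mathbb H:\vec q\neq0\}$. For $x\in\mathbb H^*$ and $u=1,2,3$, $\mu_u(x)=x_u\left(1+\frac{x_0}{\vec q}\right)$ (these commute pairwise at each $x$). For $\alpha=(\alpha_1,\alpha_2,\alpha_3)\in\mathbb N_0^3$, $\mu^\alpha(x)=\mu_1^{\alpha_1}(x)\mu_2^{\alpha_2}(x)\mu_3^{\alpha_3}(x)=x^\alpha\left(1+\frac{x_0}{\vec q}\right)^{|\alpha|}$, where $x^\alpha=x_1^{\alpha_1}x_2^{\alpha_2}x_3^{\alpha_3}$ and $|\alpha|=\alpha_1+\alpha_2+\alpha_3$. The operator $V_q$ is $$V_qf=\frac{\partial f}{\partial x_0}-\frac1{\vec q}\sum_{u=1}^3x_u\frac{\partial f}{\partial x_u},$$ where $\frac1{\vec q}$ is the quaternionic inverse of $\vec q$. *)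

theory Defs
  imports "HOL-Analysis.Analysis"
begin

text \<open>
  A quaternion is a real part together with a vector part in three-space; the product is the
  Hamilton product written with the inner and the cross product. The vector \<open>(x\<^sub>0, x\<^sub>1, x\<^sub>2, x\<^sub>3)\<close>
  of real four-space is \<open>Quat x\<^sub>0 (vector [x\<^sub>1, x\<^sub>2, x\<^sub>3])\<close>.
\<close>

datatype quat = Quat (qre: real) (qvec: "real ^ 3")

lemma quat_eq_iff: "p = q \<longleftrightarrow> qre p = qre q \<and> qvec p = qvec q"
  by (cases p; cases q) auto

instantiation quat :: real_vector
begin

definition zero_quat :: quat where "0 = Quat 0 0"
definition plus_quat :: "quat \<Rightarrow> quat \<Rightarrow> quat"
  where "p + q = Quat (qre p + qre q) (qvec p + qvec q)"
definition uminus_quat :: "quat \<Rightarrow> quat" where "- q = Quat (- qre q) (- qvec q)"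
definition minus_quat :: "quat \<Rightarrow> quat \<Rightarrow> quat"
  where "p - q = Quat (qre p - qre q) (qvec p - qvec q)"
definition scaleR_quat :: "real \<Rightarrow> quat \<Rightarrow> quat"
  where "r *\<^sub>R q = Quat (r * qre q) (r *\<^sub>R qvec q)"

instance
  by standard
    (simp_all add: quat_eq_iff zero_quat_def plus_quat_def uminus_quat_def minus_quat_def
      scaleR_quat_def algebra_simps)

end

lemma quat_sel_simps [simp]:
  "qre 0 = 0" "qvec 0 = 0"
  "qre (p + q) = qre p + qre q" "qvec (p + q) = qvec p + qvec q"
  "qre (- p) = - qre p" "qvec (- p) = - qvec p"
  "qre (p - q) = qre p - qre q" "qvec (p - q) = qvec p - qvec q"
  "qre (r *\<^sub>R p) = r * qre p" "qvec (r *\<^sub>R p) = r *\<^sub>R qvec p"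
  by (simp_all add: zero_quat_def plus_quat_def uminus_quat_def minus_quat_def scaleR_quat_def)

instantiation quat :: real_inner
begin

definition inner_quat :: "quat \<Rightarrow> quat \<Rightarrow> real"
  where "p \<bullet> q = qre p * qre q + qvec p \<bullet> qvec q"
definition norm_quat :: "quat \<Rightarrow> real" where "norm (q::quat) = sqrt (q \<bullet> q)"
definition sgn_quat :: "quat \<Rightarrow> quat" where "sgn (q::quat) = q /\<^sub>R norm q"
definition dist_quat :: "quat \<Rightarrow> quat \<Rightarrow> real" where "dist (p::quat) q = norm (p - q)"
definition uniformity_quat :: "(quat \<times> quat) filter"
  where "uniformity = (INF e\<in>{0 <..}. principal {(p::quat, q). dist p q < e})"
definition open_quat :: "quat set \<Rightarrow> bool"
  where "open (U::quat set) \<longleftrightarrow> (\<forall>p\<in>U. \<forall>\<^sub>F (p', q) in uniformity. p' = p \<longrightarrow> q \<in> U)"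

instance
proof
  fix p q r :: quat and a :: real
  show "p \<bullet> q = q \<bullet> p" "(p + q) \<bullet> r = p \<bullet> r + q \<bullet> r" "(a *\<^sub>R p) \<bullet> q = a * (p \<bullet> q)"
    by (simp_all add: inner_quat_def inner_commute algebra_simps)
  show "0 \<le> p \<bullet> p"
    by (simp add: inner_quat_def)
  show "p \<bullet> p = 0 \<longleftrightarrow> p = 0"
    by (auto simp: inner_quat_def quat_eq_iff add_nonneg_eq_0_iff)
qed (rule norm_quat_def sgn_quat_def dist_quat_def uniformity_quat_def open_quat_def)+

end

lemma norm_quat_power2: "(norm q)\<^sup>2 = (qre q)\<^sup>2 + (norm (qvec q))\<^sup>2" for q :: quat
  unfolding power2_norm_eq_inner by (simp add: inner_quat_def power2_eq_square)

instantiation quat :: real_normed_div_algebra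
begin

definition one_quat :: quat where "1 = Quat 1 0"
definition times_quat :: "quat \<Rightarrow> quat \<Rightarrow> quat"
  where "p * q = Quat (qre p * qre q - qvec p \<bullet> qvec q)
                      (qre p *\<^sub>R qvec q + qre q *\<^sub>R qvec p + cross3 (qvec p) (qvec q))"
definition inverse_quat :: "quat \<Rightarrow> quat"
  where "inverse q = Quat (qre q) (- qvec q) /\<^sub>R (norm q)\<^sup>2"
definition divide_quat :: "quat \<Rightarrow> quat \<Rightarrow> quat" where "p div q = p * inverse (q::quat)"

instance
proof
  fix p q r :: quat and a :: real
  show "p * q * r = p * (q * r)" "(p + q) * r = p * r + q * r" "p * (q + r) = p * q + p * r"
    "1 * p = p" "p * 1 = p" "a *\<^sub>R p * q = a *\<^sub>R (p * q)" "p * a *\<^sub>R q = a *\<^sub>R (p * q)"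
    by (simp_all add: quat_eq_iff times_quat_def one_quat_def cross3_simps inner_vec_def sum_3)
      (use exhaust_3 in blast)
  show "(0::quat) \<noteq> 1" "inverse 0 = (0::quat)" "p div q = p * inverse q"
    by (simp_all add: quat_eq_iff one_quat_def inverse_quat_def divide_quat_def)
  show "inverse p * p = 1" "p * inverse p = 1" if "p \<noteq> 0"
  proof -
    have "(norm p)\<^sup>2 \<noteq> 0"
      using that by simp
    moreover have "qre p * qre p + qvec p \<bullet> qvec p = (norm p)\<^sup>2"
      by (simp add: power2_norm_eq_inner inner_quat_def)
    ultimately have "qre p * (qre p * inverse ((norm p)\<^sup>2)) + qvec p \<bullet> qvec p * inverse ((norm p)\<^sup>2) = 1"
      by (metis distrib_right mult.assoc right_inverse)
    then show "inverse p * p = 1" "p * inverse p = 1"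
      by (simp_all add: quat_eq_iff times_quat_def one_quat_def inverse_quat_def
          cross_minus_left cross_minus_right cross_mult_left cross_mult_right
          cross_refl mult.assoc mult.commute)
  qed
  have "(norm (p * q))\<^sup>2 = (norm p * norm q)\<^sup>2"
    unfolding power_mult_distrib norm_quat_power2 power2_norm_eq_inner times_quat_def quat.sel
      inner_vec_def
    by (simp add: cross3_simps sum_3 power2_eq_square)
  then show "norm (p * q) = norm p * norm q"
    by (simp add: power2_eq_iff_nonneg)
qed

end

definition qunit :: "3 \<Rightarrow> quat"
  where "qunit u = Quat 0 (axis u 1)"

definition qcoord :: "3 \<Rightarrow> quat \<Rightarrow> real"
  where "qcoord u q = qvec q $ u"

definition qvecpart :: "quat \<Rightarrow> quat"
  where "qvecpart q = (\<Sum>u\<in>UNIV. qcoord u q *\<^sub>R qunit u)"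

lemma qvecpart_eq: "qvecpart q = Quat 0 (qvec q)"
  by (simp add: qvecpart_def qcoord_def qunit_def quat_eq_iff sum_3 vec_eq_iff axis_def forall_3)

lemma quat_decompose: "q = of_real (qre q) + qvecpart q"
  by (simp add: qvecpart_eq quat_eq_iff of_real_def one_quat_def)

lemma qunit_mult:
  "qunit u * qunit u = - 1"
  "qunit 1 * qunit 2 = qunit 3" "qunit 2 * qunit 3 = qunit 1" "qunit 3 * qunit 1 = qunit 2"
  "qunit 2 * qunit 1 = - qunit 3" "qunit 3 * qunit 2 = - qunit 1" "qunit 1 * qunit 3 = - qunit 2"
  using exhaust_3[of u]
  by (auto simp: quat_eq_iff times_quat_def one_quat_def qunit_def cross3_simps axis_def
      inner_axis_axis)

definition quat_nonreal :: "quat set"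
  where "quat_nonreal = {q. qvecpart q \<noteq> 0}"

definition mu :: "3 \<Rightarrow> quat \<Rightarrow> quat"
  where "mu u x = qcoord u x *\<^sub>R (1 + of_real (qre x) / qvecpart x)"

definition mu_multi :: "nat ^ 3 \<Rightarrow> quat \<Rightarrow> quat"
  where "mu_multi \<alpha> x = mu 1 x ^ (\<alpha> $ 1) * mu 2 x ^ (\<alpha> $ 2) * mu 3 x ^ (\<alpha> $ 3)"

lemma mu_commute: "mu u x * mu v x = mu v x * mu u x"
  by (simp add: mu_def)

lemma mu_multi_eq:
  "mu_multi \<alpha> x = (\<Prod>u\<in>UNIV. qcoord u x ^ (\<alpha> $ u)) *\<^sub>R
     (1 + of_real (qre x) / qvecpart x) ^ (\<Sum>u\<in>UNIV. \<alpha> $ u)"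
proof -
  have "prod f (UNIV :: 3 set) = f 1 * f 2 * f 3" for f :: "3 \<Rightarrow> real"
    unfolding UNIV_3 by (simp add: ac_simps)
  then show ?thesis
    by (simp add: mu_multi_def mu_def sum_3 power_add scaleR_power mult.assoc mult.left_commute)
qed

text \<open>
  The partial derivatives are the derivatives along the coordinate lines: along \<open>1\<close> for \<open>x\<^sub>0\<close> and
  along \<open>qunit u\<close> for \<open>x\<^sub>u\<close>. As \<^const>\<open>vector_derivative\<close> is a total function, the existence of the
  partial derivatives is the separate predicate \<open>has_partials\<close>.
\<close>

definition partial_along :: "quat \<Rightarrow> (quat \<Rightarrow> quat) \<Rightarrow> quat \<Rightarrow> quat"
  where "partial_along d f x = vector_derivative (\<lambda>t. f (x + t *\<^sub>R d)) (at 0)"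

definition has_partials :: "(quat \<Rightarrow> quat) \<Rightarrow> quat \<Rightarrow> bool"
  where "has_partials f x \<longleftrightarrow>
    (\<forall>d \<in> insert 1 (range qunit). (\<lambda>t. f (x + t *\<^sub>R d)) differentiable at (0::real))"

definition V_op :: "(quat \<Rightarrow> quat) \<Rightarrow> quat \<Rightarrow> quat"
  where "V_op f x = partial_along 1 f x
    - inverse (qvecpart x) * (\<Sum>u\<in>UNIV. qcoord u x *\<^sub>R partial_along (qunit u) f x)"

end

theory Submission
  imports Defs
begin

text \<open>
  By linearity the sum in \<^const>\<open>V_op\<close> is the derivative in the direction \<open>v = qvecpart x\<close>. With
  \<open>w = 1 + x\<^sub>0 / v\<close> and \<open>n = |\<alpha>|\<close>, the function \<open>\<mu>\<^sup>\<alpha>\<close> restricts to \<open>x\<^sup>\<alpha> (w + t / v)\<^sup>n\<close> on the line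
  \<open>x + t\<close> and, near \<open>t = 0\<close>, to \<open>x\<^sup>\<alpha> (w + t)\<^sup>n\<close> on the line \<open>x + t v\<close>. In both cases everything
  commutes with \<open>w\<close>, so the two derivatives at \<open>0\<close> differ by the factor \<open>1 / v\<close>.
\<close>

lemma differentiable_power_normed_algebra:
  fixes f :: "'a::real_normed_vector \<Rightarrow> 'b::real_normed_algebra_1"
  assumes "f differentiable (at x within S)"
  shows "(\<lambda>y. f y ^ n) differentiable (at x within S)"
  by (induction n) (auto intro: differentiable_mult assms)

text \<open>In general the product rule yields the \<open>n\<close> terms
  \<open>w ^ i * c * w ^ (n - 1 - i)\<close>; commutation of \<open>c\<close> with \<open>w\<close>
  makes them all equal, which restores the usual power rule.\<close>

lemma has_vector_derivative_power_commuting: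
  fixes w c :: "'a::real_normed_algebra_1"
  assumes "w * c = c * w"
  shows "((\<lambda>t. (w + t *\<^sub>R c) ^ n) has_vector_derivative of_nat n * w ^ (n - 1) * c) (at 0)"
proof (induction n)
  case (Suc n)
  have comm: "w ^ k * c = c * w ^ k" for k
    using assms power_commuting_commutes[of w c k] by simp
  have "((\<lambda>t. w + t *\<^sub>R c) has_vector_derivative c) (at 0)"
    by (auto intro!: derivative_eq_intros)
  from has_vector_derivative_mult[OF this Suc.IH]
  have "((\<lambda>t. (w + t *\<^sub>R c) ^ Suc n) has_vector_derivative
      w * (of_nat n * w ^ (n - 1) * c) + c * w ^ n) (at 0)"
    by simp
  moreover have "w * (of_nat n * w ^ (n - 1) * c) = of_nat n * w ^ n * c"
  proof -
    have "w * (of_nat n * w ^ (n - 1) * c) = of_nat n * (w * w ^ (n - 1)) * c"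
      by (metis mult.assoc mult_of_nat_commute)
    \<comment> \<open>For \<open>n = 0\<close> truncated subtraction gives \<open>n - 1 = 0\<close>,
      so \<open>w * w ^ (n - 1)\<close> need not be \<open>w ^ n\<close>; the factor
      \<open>of_nat n\<close> is then zero and both sides vanish.\<close>
    then show ?thesis
      by (cases n) simp_all
  qed
  ultimately show ?case
    by (simp add: comm algebra_simps)
qed simp

lemma bounded_linear_qre: "bounded_linear qre"
proof -
  have *: "qre = (\<lambda>q. q \<bullet> 1)"
    by (simp add: fun_eq_iff inner_quat_def one_quat_def)
  show ?thesis
    unfolding * by (rule bounded_linear_inner_left)
qed

lemma bounded_linear_qcoord: "bounded_linear (qcoord u)"
proof -
  have *: "qcoord u = (\<lambda>q. q \<bullet> qunit u)"
    by (simp add: fun_eq_iff inner_quat_def qunit_def qcoord_def inner_axis)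
  show ?thesis
    unfolding * by (rule bounded_linear_inner_left)
qed

lemma bounded_linear_qvecpart: "bounded_linear qvecpart"
  unfolding qvecpart_def
  by (intro bounded_linear_sum bounded_linear_scaleR_const bounded_linear_qcoord)

text \<open>The coordinates, the real part and the vector part are linear, so the only possible
  singularity is the inverse at a vanishing vector part.\<close>

lemma mu_differentiable:
  assumes "qvecpart x \<noteq> 0"
  shows "mu u differentiable (at x)"
proof -
  have "qre differentiable (at x)" "qcoord u differentiable (at x)" "qvecpart differentiable (at x)"
    using bounded_linear_qre bounded_linear_qcoord bounded_linear_qvecpart
    by (auto intro: bounded_linear_imp_differentiable)
  moreover have "(\<lambda>y. inverse (qvecpart y)) differentiable (at x)"
    using Deriv.has_derivative_inverse[of qvecpart x, OF assms]
      bounded_linear_imp_has_derivative[OF bounded_linear_qvecpart]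
    unfolding differentiable_def by blast
  ultimately show ?thesis
    unfolding mu_def divide_quat_def of_real_def
    by (intro differentiable_scaleR differentiable_add differentiable_mult differentiable_const) auto
qed

lemma mu_multi_differentiable:
  assumes "qvecpart x \<noteq> 0"
  shows "mu_multi \<alpha> differentiable (at x)"
  unfolding mu_multi_def
  by (intro differentiable_mult differentiable_power_normed_algebra mu_differentiable assms)

lemma has_vector_derivative_along_line:
  assumes "(f has_derivative D) (at x)"
  shows "((\<lambda>t. f (x + t *\<^sub>R d)) has_vector_derivative D d) (at 0)"
proof -
  have line: "((\<lambda>t. x + t *\<^sub>R d) has_vector_derivative d) (at 0)"
    by (auto intro!: derivative_eq_intros)
  from assms have "(f has_derivative D) (at (x + 0 *\<^sub>R d))"
    by simp
  with line show ?thesis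
    using vector_derivative_diff_chain_within[of "\<lambda>t. x + t *\<^sub>R d" d 0 UNIV f D]
    by (auto simp: o_def intro: has_derivative_at_withinI)
qed

lemma partial_along_eq:
  assumes "(f has_derivative D) (at x)"
  shows "partial_along d f x = D d"
  unfolding partial_along_def
  using has_vector_derivative_along_line[OF assms] by (rule vector_derivative_at)

lemma has_partials_if_differentiable:
  assumes "f differentiable (at x)"
  shows "has_partials f x"
  using assms has_vector_derivative_along_line
  unfolding has_partials_def differentiable_def[of f] by (blast intro: differentiableI_vector)

text \<open>Total differentiability matters here: existence of the partial derivatives alone would
  not make their weighted sum a directional derivative.\<close>

lemma V_op_eq:
  assumes "(f has_derivative D) (at x)"
  shows "V_op f x = D 1 - inverse (qvecpart x) * D (qvecpart x)"
proof -
  have "linear D"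
    using assms by (rule has_derivative_linear)
  then have "D (qvecpart x) = (\<Sum>u\<in>UNIV. qcoord u x *\<^sub>R D (qunit u))"
    by (simp add: qvecpart_def linear_sum linear_scale)
  then show ?thesis
    by (simp add: V_op_def partial_along_eq[OF assms])
qed

lemma V_op_mu_multi:
  assumes "qvecpart x \<noteq> 0"
  shows "V_op (mu_multi \<alpha>) x = 0"
proof -
  define v where "v = qvecpart x"
  define w where "w = 1 + of_real (qre x) * inverse v"
  define n where "n = (\<Sum>u\<in>UNIV. \<alpha> $ u)"
  define p where "p = (\<Prod>u\<in>UNIV. qcoord u x ^ (\<alpha> $ u))"
  have "v \<noteq> 0"
    using assms by (simp add: v_def)
  \<comment> \<open>\<open>w\<close> is 1 plus a real multiple of \<open>inverse v\<close>.\<close>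
  have comm: "w * inverse v = inverse v * w"
    by (simp add: w_def algebra_simps of_real_def)
  obtain D where D: "(mu_multi \<alpha> has_derivative D) (at x)"
    using mu_multi_differentiable[OF assms] by (auto simp: differentiable_def)

  \<comment> \<open>Moving along the real axis fixes the vector part and replaces
    \<open>qre x\<close> by \<open>qre x + t\<close>.\<close>
  have "mu_multi \<alpha> (x + t *\<^sub>R 1) = p *\<^sub>R (w + t *\<^sub>R inverse v) ^ n" for t
  proof -
    have "qcoord u (x + t *\<^sub>R 1) = qcoord u x" "qre (1 :: quat) = 1"
      "qvecpart (x + t *\<^sub>R 1) = v" for u
      by (simp_all add: v_def qcoord_def qvecpart_eq one_quat_def)
    then show ?thesis
      by (simp add: mu_multi_eq p_def n_def w_def divide_inverse of_real_def algebra_simps)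
  qed
  moreover have "((\<lambda>t. p *\<^sub>R (w + t *\<^sub>R inverse v) ^ n) has_vector_derivative
      p *\<^sub>R (of_nat n * w ^ (n - 1) * inverse v)) (at 0)"
    using comm by (auto intro!: derivative_eq_intros has_vector_derivative_power_commuting)
  ultimately have D1: "D 1 = p *\<^sub>R (of_nat n * w ^ (n - 1) * inverse v)"
    using vector_derivative_unique_at has_vector_derivative_along_line[OF D, of 1] by fastforce

  \<comment> \<open>At \<open>t = -1\<close> the line meets the real axis, where
    \<open>inverse\<close> has its default value 0; the interval keeps \<open>1 + t\<close>
    nonzero.\<close>
  have "mu_multi \<alpha> (x + t *\<^sub>R v) = p *\<^sub>R (w + t *\<^sub>R 1) ^ n" if "t \<in> {-1<..<1}" for t
  proof -
    have "qcoord u (x + t *\<^sub>R v) = (1 + t) * qcoord u x" for u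
      by (simp add: qcoord_def v_def qvecpart_eq algebra_simps)
    then have prod: "(\<Prod>u\<in>UNIV. qcoord u (x + t *\<^sub>R v) ^ (\<alpha> $ u)) = (1 + t) ^ n * p"
      by (simp add: power_mult_distrib prod.distrib p_def n_def power_sum)
    have "qre v = 0" "qvecpart (x + t *\<^sub>R v) = (1 + t) *\<^sub>R v"
      by (simp_all add: v_def qvecpart_eq quat_eq_iff algebra_simps)
    \<comment> \<open>The coordinates contribute \<open>(1 + t) ^ n\<close>. Moved inside the power,
      \<open>1 + t\<close> cancels the scaling of \<open>v\<close> under the inverse.\<close>
    then have "mu_multi \<alpha> (x + t *\<^sub>R v)
        = p *\<^sub>R ((1 + t) *\<^sub>R (1 + of_real (qre x) * inverse ((1 + t) *\<^sub>R v))) ^ n"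
      by (simp add: mu_multi_eq prod divide_inverse scaleR_power mult.commute flip: n_def)
    also have "(1 + t) *\<^sub>R (1 + of_real (qre x) * inverse ((1 + t) *\<^sub>R v)) = w + t *\<^sub>R 1"
    proof -
      have "(1 + t) *\<^sub>R inverse ((1 + t) *\<^sub>R v) = inverse v"
        using that \<open>v \<noteq> 0\<close> nonzero_inverse_scaleR_distrib[of "1 + t" v] by simp
      then have "(1 + t) *\<^sub>R (of_real (qre x) * inverse ((1 + t) *\<^sub>R v)) = of_real (qre x) * inverse v"
        by (metis mult_scaleR_right)
      then show ?thesis
        by (simp only: w_def scaleR_add_right) (simp add: scaleR_add_left)
    qed
    finally show ?thesis .
  qed
  moreover have "((\<lambda>t. p *\<^sub>R (w + t *\<^sub>R 1) ^ n) has_vector_derivative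
      p *\<^sub>R (of_nat n * w ^ (n - 1) * 1)) (at 0)"
    by (intro bounded_linear.has_vector_derivative[OF bounded_linear_scaleR_right]
        has_vector_derivative_power_commuting) simp
  ultimately have "((\<lambda>t. mu_multi \<alpha> (x + t *\<^sub>R v)) has_vector_derivative
      p *\<^sub>R (of_nat n * w ^ (n - 1) * 1)) (at 0)"
    by (auto intro: has_vector_derivative_transform_within_open[where S = "{-1<..<1}"])
  then have Dv: "D v = p *\<^sub>R (of_nat n * w ^ (n - 1))"
    using vector_derivative_unique_at has_vector_derivative_along_line[OF D, of v] by fastforce

  \<comment> \<open>\<open>V_op\<close> multiplies by \<open>inverse v\<close> on the left, while
    \<open>D 1\<close> carries it on the right.\<close>
  have "inverse v * (of_nat n * w ^ (n - 1)) = of_nat n * w ^ (n - 1) * inverse v"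
    using power_commuting_commutes[OF comm, of "n - 1"]
    by (metis mult.assoc mult_of_nat_commute)
  then show ?thesis
    by (simp add: V_op_eq[OF D] D1 Dv flip: v_def)
qed

theorem theorem3p6:
  fixes \<Omega> :: "quat set" and \<alpha> :: "nat ^ 3"
  assumes "open \<Omega>" and "connected \<Omega>" and "\<Omega> \<subseteq> quat_nonreal"
  shows "\<forall>x\<in>\<Omega>. has_partials (mu_multi \<alpha>) x \<and> V_op (mu_multi \<alpha>) x = 0"
  using assms(3) V_op_mu_multi has_partials_if_differentiable mu_multi_differentiable
  by (auto simp: quat_nonreal_def)

end
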